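(* Let $m \geq 1$ be an integer. Then $I(C_{m,2}) \simeq S^{\lceil m/2 \rceil - 1}$ and $Z(C_{m,2}) = (-1)^{\lceil m/2 \rceil}$.
   Context: For integers $m\ge 1$, $n \geq 2$, $C_{m,n}$ is the graph with vertex set $\{1,\dots,m\}\times\{1,\dots,n\}$ in which distinct vertices $(i,j)$ and $(i',j')$ are adjacent if and only if either $i=i'$ and $j-j' \equiv \pm 1 \pmod n$, or $j=j'$ and $|i-i'|=1$. For a finite simple graph $G$, the independence complex $I(G)$ is the simplicial complex on the ground set $V(G)$ whose faces are all independent sets of $G$ (including $\emptyset$), and $Z(G) = \sum_{\sigma \in I(G)} (-1)^{|\sigma|}$. $\simeq$ denotes homotopy equivalence (of geometric realizations) and $S^d$ is the $d$-dimensional sphere. *)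

theory Defs
  imports "HOL-Analysis.Analysis" "HOL-Number_Theory.Cong" "Graph_Theory.Pair_Digraph"
begin

text \<open>
  Finite simple graphs are the instances of the locale \<^locale>\<open>pair_graph\<close>: an undirected edge
  is represented by its two opposite arcs.  The vertex coordinates are integers, so that
  the differences below are not truncated.
\<close>

definition cyl_adj :: "nat \<Rightarrow> int \<times> int \<Rightarrow> int \<times> int \<Rightarrow> bool" where
  "cyl_adj n = (\<lambda>(i, j) (i', j').
     (i = i' \<and> ([j - j' = 1] (mod int n) \<or> [j - j' = -1] (mod int n))) \<or>
     (j = j' \<and> \<bar>i - i'\<bar> = 1))"

definition cyl_graph :: "nat \<Rightarrow> nat \<Rightarrow> (int \<times> int) pair_pre_digraph" where
  "cyl_graph m n =
     \<lparr> pverts = {1..int m} \<times> {1..int n},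
       parcs = {(u, v). u \<in> {1..int m} \<times> {1..int n} \<and> v \<in> {1..int m} \<times> {1..int n} \<and>
                        u \<noteq> v \<and> cyl_adj n u v} \<rparr>"

lemma cyl_adj_sym: "cyl_adj n u v \<Longrightarrow> cyl_adj n v u"
proof -
  have neg: "[b - a = - c] (mod int n)" if "[a - b = c] (mod int n)" for a b c :: int
    using that cong_minus_minus_iff[of "a - b" c "int n"] by simp
  assume "cyl_adj n u v"
  then show ?thesis
    using neg[of "snd u" "snd v" 1] neg[of "snd u" "snd v" "-1"]
    by (auto simp: cyl_adj_def abs_minus_commute split: prod.splits)
qed

lemma pair_graph_cyl_graph: "pair_graph (cyl_graph m n)"
proof
  show "finite (parcs (cyl_graph m n))"
    by (rule finite_subset[of _ "({1..int m} \<times> {1..int n}) \<times> ({1..int m} \<times> {1..int n})"])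
       (auto simp: cyl_graph_def)
  show "symmetric (with_proj (cyl_graph m n))"
    unfolding symmetric_def with_proj_simps
    by (rule symI) (auto simp: cyl_graph_def intro: cyl_adj_sym)
qed (auto simp: cyl_graph_def)

definition indep_complex :: "'a pair_pre_digraph \<Rightarrow> 'a set set" where
  "indep_complex G = {\<sigma>. \<sigma> \<subseteq> pverts G \<and> (\<forall>u\<in>\<sigma>. \<forall>v\<in>\<sigma>. (u, v) \<notin> parcs G)}"

definition indep_Z :: "'a pair_pre_digraph \<Rightarrow> int" where
  "indep_Z G = (\<Sum>\<sigma>\<in>indep_complex G. (-1) ^ card \<sigma>)"

text \<open>
  The realization of a finite simplicial complex consists of the barycentric coordinate
  functions \<open>x\<close> on the vertices, extended by 0, whose support is a face.  The face \<open>{}\<close>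
  contributes no point, since the coordinates have to sum to 1.  The product topology is the
  usual topology of the realization only because the complex is finite.
\<close>

definition geom_realization :: "'a set set \<Rightarrow> ('a \<Rightarrow> real) topology" where
  "geom_realization K = subtopology (powertop_real UNIV)
     {x. (\<forall>v. 0 \<le> x v) \<and> {v. x v \<noteq> 0} \<in> K \<and> (\<Sum>v | x v \<noteq> 0. x v) = 1}"

end

theory Submission
  imports Defs
begin

text \<open>
  The graph \<open>C\<^bsub>m,2\<^esub>\<close> is a ladder: column \<open>i\<close> consists of two adjacent vertices, and consecutive
  columns are joined by two parallel edges.  If a face of a complex that contains \<open>v\<close> stays a face
  when \<open>u\<close> is added, that is, if the link of \<open>v\<close> is a cone with apex \<open>u\<close>, then \<open>v\<close> can be removed:
  moving the weight of \<open>v\<close> to \<open>u\<close> is a deformation retraction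
  (\<open>realization_remove_dominated\<close>), and adding or dropping \<open>u\<close> pairs off the faces through \<open>v\<close>
  with opposite signs (\<open>alternating_sum_remove_dominated\<close>).

  In an independence complex this hypothesis says that every neighbour of \<open>u\<close> is a neighbour of
  \<open>v\<close>.  In the ladder, \<open>(1, 2)\<close> has the neighbours \<open>(1, 1)\<close> and \<open>(2, 2)\<close>, both adjacent to
  \<open>(2, 1)\<close>; symmetrically \<open>(1, 1)\<close> dominates \<open>(2, 2)\<close>.  So column 2 can be removed.  Now column 3
  is at the left end of a ladder, hence column 4 can be removed, and so on
  (\<open>ladder_remove_column\<close>).  In the end only the odd columns are left: \<open>\<lceil>m/2\<rceil>\<close> disjoint edges.
  A face contains at most one end of each of them, which makes the complex the boundary of a
  cross-polytope of dimension \<open>\<lceil>m/2\<rceil>\<close>.  Taking the difference of the weights of the two ends of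
  each edge as a coordinate and normalizing gives a homeomorphism to the sphere
  (\<open>cross_polytope_homeomorphic_nsphere\<close>); each further edge multiplies the alternating sum by
  \<open>1 - 1 - 1 = -1\<close> (\<open>alternating_sum_cross_polytope\<close>).
\<close>

section \<open>Removing a dominated vertex\<close>

definition realization_points :: "'a set set \<Rightarrow> ('a \<Rightarrow> real) set" where
  "realization_points K = {x. (\<forall>v. 0 \<le> x v) \<and> {v. x v \<noteq> 0} \<in> K \<and> (\<Sum>v | x v \<noteq> 0. x v) = 1}"

lemma geom_realization_eq: "geom_realization K = top_of_set (realization_points K)"
  by (simp add: geom_realization_def realization_points_def euclidean_product_topology)

definition push_weight :: "'a \<Rightarrow> 'a \<Rightarrow> real \<Rightarrow> ('a \<Rightarrow> real) \<Rightarrow> 'a \<Rightarrow> real" where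
  "push_weight v u t x = x(u := x u + t * x v, v := (1 - t) * x v)"

lemma continuous_on_push_weight:
  "continuous_on S (\<lambda>z. push_weight v u (fst z) (snd z))"
proof (rule continuous_on_coordinatewise_then_product)
  fix i
  have coord: "continuous_on S (\<lambda>z. snd z w)" for w
    by (rule continuous_on_product_then_coordinatewise) (intro continuous_intros)
  consider "i = v" | "i = u" "i \<noteq> v" | "i \<noteq> u" "i \<noteq> v" by blast
  then show "continuous_on S (\<lambda>z. push_weight v u (fst z) (snd z) i)"
    by cases (simp_all add: push_weight_def, (intro continuous_intros coord)+)
qed

lemma push_weight_in_realization:
  assumes fin: "\<And>\<sigma>. \<sigma> \<in> K \<Longrightarrow> finite \<sigma>"
    and down: "\<And>\<sigma> \<tau>. \<sigma> \<in> K \<Longrightarrow> \<tau> \<subseteq> \<sigma> \<Longrightarrow> \<tau> \<in> K"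
    and dom: "\<And>\<sigma>. \<sigma> \<in> K \<Longrightarrow> v \<in> \<sigma> \<Longrightarrow> insert u \<sigma> \<in> K"
    and "u \<noteq> v" and x: "x \<in> realization_points K" and t: "0 \<le> t" "t \<le> 1"
  shows "push_weight v u t x \<in> realization_points K"
proof -
  let ?y = "push_weight v u t x"
  let ?S = "insert u (insert v {w. x w \<noteq> 0})"
  have supp: "{w. x w \<noteq> 0} \<in> K" and nonneg: "\<And>w. 0 \<le> x w"
    and total: "(\<Sum>w | x w \<noteq> 0. x w) = 1"
    using x by (auto simp: realization_points_def)
  have finS: "finite ?S" using fin[OF supp] by simp
  have "{w. ?y w \<noteq> 0} \<in> K"
  proof (cases "x v = 0")
    case True
    then have "?y = x" by (auto simp: push_weight_def)
    with supp show ?thesis by simp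
  next
    case False
    have "{w. ?y w \<noteq> 0} \<subseteq> insert u {w. x w \<noteq> 0}"
      by (auto simp: push_weight_def split: if_splits)
    with dom[OF supp] False down show ?thesis by blast
  qed
  moreover have "(\<Sum>w | ?y w \<noteq> 0. ?y w) = 1"
  proof -
    have rest: "(\<Sum>w\<in>?S - {u} - {v}. ?y w) = (\<Sum>w\<in>?S - {u} - {v}. x w)"
      by (rule sum.cong) (auto simp: push_weight_def)
    have split: "(\<Sum>w\<in>?S. f w) = f u + (f v + (\<Sum>w\<in>?S - {u} - {v}. f w))" for f :: "'a \<Rightarrow> real"
      using finS \<open>u \<noteq> v\<close> by (subst sum.remove[of _ u], simp, simp, subst sum.remove[of _ v]) auto
    have "(\<Sum>w | ?y w \<noteq> 0. ?y w) = (\<Sum>w\<in>?S. ?y w)"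
      by (rule sum.mono_neutral_left[OF finS]) (auto simp: push_weight_def split: if_splits)
    also have "\<dots> = ?y u + (?y v + (\<Sum>w\<in>?S - {u} - {v}. x w))"
      by (simp only: split rest)
    also have "\<dots> = x u + (x v + (\<Sum>w\<in>?S - {u} - {v}. x w))"
      using \<open>u \<noteq> v\<close> by (simp add: push_weight_def algebra_simps)
    also have "\<dots> = (\<Sum>w\<in>?S. x w)"
      by (simp only: split)
    also have "\<dots> = (\<Sum>w | x w \<noteq> 0. x w)"
      by (rule sum.mono_neutral_right[OF finS]) auto
    finally show ?thesis using total by simp
  qed
  moreover have "0 \<le> ?y w" for w
    using nonneg t by (simp add: push_weight_def)
  ultimately show ?thesis by (simp add: realization_points_def)
qed

text \<open>
  The straight-line homotopy \<open>push_weight v u t\<close> stays in the realization because a point that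
  gives weight to \<open>v\<close> lies in a face to which \<open>u\<close> can be added; at time 1 no weight is left on \<open>v\<close>.
\<close>

lemma realization_remove_dominated:
  assumes fin: "\<And>\<sigma>. \<sigma> \<in> K \<Longrightarrow> finite \<sigma>"
    and down: "\<And>\<sigma> \<tau>. \<sigma> \<in> K \<Longrightarrow> \<tau> \<subseteq> \<sigma> \<Longrightarrow> \<tau> \<in> K"
    and dom: "\<And>\<sigma>. \<sigma> \<in> K \<Longrightarrow> v \<in> \<sigma> \<Longrightarrow> insert u \<sigma> \<in> K"
    and "u \<noteq> v"
  shows "geom_realization K homotopy_equivalent_space geom_realization {\<sigma>\<in>K. v \<notin> \<sigma>}"
proof (rule deformation_retraction_imp_homotopy_equivalent_space)
  let ?L = "{\<sigma>\<in>K. v \<notin> \<sigma>}"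
  have push: "push_weight v u t x \<in> realization_points K"
    if "x \<in> realization_points K" "0 \<le> t" "t \<le> 1" for x t
    by (rule push_weight_in_realization[where K = K])
      (fact fin, fact down, fact dom, fact \<open>u \<noteq> v\<close>, (fact that)+)
  have L: "x \<in> realization_points ?L \<longleftrightarrow> x \<in> realization_points K \<and> x v = 0" for x
    by (auto simp: realization_points_def)
  have cont: "continuous_on S (push_weight v u 1)" for S
  proof -
    have "continuous_on S (\<lambda>x :: 'a \<Rightarrow> real. (1 :: real, x))"
      by (intro continuous_intros)
    from continuous_on_compose2[OF continuous_on_push_weight[of UNIV v u] this]
    show ?thesis by simp
  qed
  have fixed: "x v = 0 \<Longrightarrow> push_weight v u t x = x" and cleared: "push_weight v u 1 x v = 0"
    and start: "push_weight v u 0 x = x" for t x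
    by (auto simp: push_weight_def)
  show "retraction_maps (geom_realization K) (geom_realization ?L) (push_weight v u 1) id"
    unfolding retraction_maps_def geom_realization_eq
  proof (intro conjI)
    have "push_weight v u 1 \<in> realization_points K \<rightarrow> realization_points ?L"
      by (simp add: Pi_iff L push cleared)
    then show "continuous_map (top_of_set (realization_points K))
        (top_of_set (realization_points ?L)) (push_weight v u 1)"
      by (simp only: continuous_map_subtopology_eu cont simp_thms)
    show "continuous_map (top_of_set (realization_points ?L))
        (top_of_set (realization_points K)) id"
      by (simp add: Pi_iff L)
    show "\<forall>x\<in>topspace (top_of_set (realization_points ?L)). push_weight v u 1 (id x) = x"
      by (simp add: L fixed)
  qed
  have "homotopic_with (\<lambda>x. True) (geom_realization K) (geom_realization K) id
          (id \<circ> push_weight v u 1)"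
    unfolding homotopic_with_def geom_realization_eq
  proof (intro exI[of _ "\<lambda>z. push_weight v u (fst z) (snd z)"] conjI)
    have "(\<lambda>z. push_weight v u (fst z) (snd z))
        \<in> {0..1} \<times> realization_points K \<rightarrow> realization_points K"
      by (simp add: Pi_iff push)
    then show "continuous_map
        (prod_topology (top_of_set {0..1}) (top_of_set (realization_points K)))
        (top_of_set (realization_points K)) (\<lambda>z. push_weight v u (fst z) (snd z))"
      by (simp only: prod_topology_subtopology_eu continuous_map_subtopology_eu
          continuous_on_push_weight simp_thms)
  qed (simp_all add: start)
  then show "homotopic_with (\<lambda>x. True) (geom_realization K) (geom_realization K)
      (id \<circ> push_weight v u 1) id"
    by (rule homotopic_with_symD)
qed

text \<open>
  Toggling the membership of \<open>u\<close> is a sign-reversing involution on the faces through \<open>v\<close>, so these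
  contribute nothing to the sum.
\<close>

lemma alternating_sum_remove_dominated:
  assumes "finite K" and fin: "\<And>\<sigma>. \<sigma> \<in> K \<Longrightarrow> finite \<sigma>"
    and down: "\<And>\<sigma> \<tau>. \<sigma> \<in> K \<Longrightarrow> \<tau> \<subseteq> \<sigma> \<Longrightarrow> \<tau> \<in> K"
    and dom: "\<And>\<sigma>. \<sigma> \<in> K \<Longrightarrow> v \<in> \<sigma> \<Longrightarrow> insert u \<sigma> \<in> K"
    and "u \<noteq> v"
  shows "(\<Sum>\<sigma>\<in>K. (-1) ^ card \<sigma> :: int) = (\<Sum>\<sigma> | \<sigma> \<in> K \<and> v \<notin> \<sigma>. (-1) ^ card \<sigma>)"
proof -
  define T where "T = {\<sigma>\<in>K. v \<in> \<sigma>}"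
  define toggle where "toggle \<sigma> = (if u \<in> \<sigma> then \<sigma> - {u} else insert u \<sigma>)" for \<sigma>
  have T: "toggle \<sigma> \<in> T" "toggle (toggle \<sigma>) = \<sigma>" if "\<sigma> \<in> T" for \<sigma>
    using that down[of \<sigma> "\<sigma> - {u}"] dom[of \<sigma>] \<open>u \<noteq> v\<close> by (auto simp: T_def toggle_def)
  have sign: "(-1) ^ card (toggle \<sigma>) = - ((-1) ^ card \<sigma> :: int)" if "\<sigma> \<in> T" for \<sigma>
  proof -
    have "finite \<sigma>" using that fin by (auto simp: T_def)
    show ?thesis
    proof (cases "u \<in> \<sigma>")
      case True
      have "(-1) ^ card (\<sigma> - {u}) = - ((-1) ^ card \<sigma> :: int)"
        by (simp only: card.remove[OF \<open>finite \<sigma>\<close> True] power_Suc mult_minus1 minus_minus)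
      with True show ?thesis by (simp only: toggle_def if_True)
    next
      case False
      with \<open>finite \<sigma>\<close> show ?thesis by (simp add: toggle_def)
    qed
  qed
  have "(\<Sum>\<sigma>\<in>T. (-1) ^ card \<sigma> :: int) = (\<Sum>\<sigma>\<in>T. - ((-1) ^ card \<sigma>))"
    by (rule sum.reindex_bij_witness[of _ toggle toggle]) (simp_all add: T sign)
  then have "(\<Sum>\<sigma>\<in>T. (-1) ^ card \<sigma> :: int) = 0"
    by (simp add: sum_negf)
  moreover have "K = {\<sigma>\<in>K. v \<notin> \<sigma>} \<union> T" "{\<sigma>\<in>K. v \<notin> \<sigma>} \<inter> T = {}"
    by (auto simp: T_def)
  ultimately show ?thesis
    using sum.union_disjoint[of "{\<sigma>\<in>K. v \<notin> \<sigma>}" T "\<lambda>\<sigma>. (-1) ^ card \<sigma> :: int"] \<open>finite K\<close>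
    by (simp add: T_def)
qed

section \<open>Boundaries of cross-polytopes\<close>

text \<open>
  The vertices \<open>p i\<close> and \<open>q i\<close> stand for the opposite vertices \<open>e\<^sub>i\<close> and \<open>-e\<^sub>i\<close> of the cross-polytope
  in dimension \<open>c\<close>; its proper faces are spanned by the sets without an opposite pair.
\<close>

definition cross_polytope :: "(nat \<Rightarrow> 'a) \<Rightarrow> (nat \<Rightarrow> 'a) \<Rightarrow> nat \<Rightarrow> 'a set set" where
  "cross_polytope p q c =
     {\<sigma>. \<sigma> \<subseteq> p ` {..<c} \<union> q ` {..<c} \<and> (\<forall>i<c. \<not> (p i \<in> \<sigma> \<and> q i \<in> \<sigma>))}"

lemma sum_over_antipodal_pairs:
  fixes f :: "'a \<Rightarrow> real" and c :: nat
  assumes "inj p" "inj q" "\<And>i j. p i \<noteq> q j"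
  shows "(\<Sum>v \<in> p ` {..<c} \<union> q ` {..<c}. f v) = (\<Sum>i<c. f (p i) + f (q i))"
proof -
  have "(\<Sum>v \<in> p ` {..<c} \<union> q ` {..<c}. f v) = (\<Sum>v \<in> p ` {..<c}. f v) + (\<Sum>v \<in> q ` {..<c}. f v)"
    by (rule sum.union_disjoint) (auto simp: assms(3))
  also have "\<dots> = (\<Sum>i<c. f (p i)) + (\<Sum>i<c. f (q i))"
    using assms(1,2) by (simp add: sum.reindex inj_on_subset)
  finally show ?thesis by (simp add: sum.distrib)
qed

lemma realization_points_cross_polytope:
  assumes "inj p" "inj q" "\<And>i j. p i \<noteq> q j"
  shows "x \<in> realization_points (cross_polytope p q c) \<longleftrightarrow>
      (\<forall>v. 0 \<le> x v) \<and> (\<forall>v. v \<notin> p ` {..<c} \<union> q ` {..<c} \<longrightarrow> x v = 0) \<and>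
      (\<forall>i<c. x (p i) = 0 \<or> x (q i) = 0) \<and> (\<Sum>i<c. x (p i) + x (q i)) = 1"
proof -
  let ?V = "p ` {..<c} \<union> q ` {..<c}"
  have total: "(\<Sum>v | x v \<noteq> 0. x v) = 1 \<longleftrightarrow> (\<Sum>i<c. x (p i) + x (q i)) = 1"
    if "\<forall>v. v \<notin> ?V \<longrightarrow> x v = 0"
  proof -
    have "(\<Sum>v | x v \<noteq> 0. x v) = (\<Sum>v\<in>?V. x v)"
      using that by (intro sum.mono_neutral_left) auto
    then show ?thesis by (simp add: sum_over_antipodal_pairs[OF assms])
  qed
  have "{v. x v \<noteq> 0} \<subseteq> ?V \<longleftrightarrow> (\<forall>v. v \<notin> ?V \<longrightarrow> x v = 0)"
    by auto
  then have "x \<in> realization_points (cross_polytope p q c) \<longleftrightarrow>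
      (\<forall>v. 0 \<le> x v) \<and> ((\<forall>v. v \<notin> ?V \<longrightarrow> x v = 0) \<and> (\<forall>i<c. x (p i) = 0 \<or> x (q i) = 0)) \<and>
      (\<Sum>v | x v \<noteq> 0. x v) = 1"
    by (simp only: realization_points_def cross_polytope_def mem_Collect_eq de_Morgan_conj not_not)
  also have "\<dots> \<longleftrightarrow> (\<forall>v. 0 \<le> x v) \<and> (\<forall>v. v \<notin> ?V \<longrightarrow> x v = 0) \<and>
      (\<forall>i<c. x (p i) = 0 \<or> x (q i) = 0) \<and> (\<Sum>i<c. x (p i) + x (q i)) = 1"
    using total by argo
  finally show ?thesis .
qed

text \<open>
  In the coordinates \<open>x (p i) - x (q i)\<close> the realization is the unit sphere of the 1-norm, since at
  most one of the two weights is nonzero.  Dividing by the 2-norm, respectively by the 1-norm on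
  the way back, identifies it with the Euclidean unit sphere; positive and negative parts recover
  the weights.
\<close>

lemma cross_polytope_homeomorphic_nsphere:
  fixes p q :: "nat \<Rightarrow> 'a"
  assumes pq: "inj p" "inj q" "\<And>i j. p i \<noteq> q j"
  shows "geom_realization (cross_polytope p q (Suc n)) homeomorphic_space nsphere n"
proof -
  let ?P = "realization_points (cross_polytope p q (Suc n))"
  let ?Q = "{y. (\<Sum>i\<le>n. (y i)\<^sup>2) = 1 \<and> (\<forall>i>n. y i = 0)} :: (nat \<Rightarrow> real) set"
  define r where "r x = sqrt (\<Sum>j\<le>n. (x (p j) - x (q j))\<^sup>2)" for x :: "'a \<Rightarrow> real"
  define l where "l y = (\<Sum>j\<le>n. \<bar>y j\<bar>)" for y :: "nat \<Rightarrow> real"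
  define F where "F x i = (if i \<le> n then (x (p i) - x (q i)) / r x else 0)"
    for x :: "'a \<Rightarrow> real" and i
  define G where "G y v = (\<Sum>i\<le>n. (if v = p i then max (y i) 0 else 0)
      + (if v = q i then max (- y i) 0 else 0)) / l y" for y :: "nat \<Rightarrow> real" and v
  have P: "x \<in> ?P \<longleftrightarrow> (\<forall>v. 0 \<le> x v) \<and> (\<forall>v. v \<notin> p ` {..n} \<union> q ` {..n} \<longrightarrow> x v = 0) \<and>
      (\<forall>i\<le>n. x (p i) = 0 \<or> x (q i) = 0) \<and> (\<Sum>i\<le>n. x (p i) + x (q i)) = 1" for x
    by (simp add: realization_points_cross_polytope[OF pq] lessThan_Suc_atMost less_Suc_eq_le)
  have one: "(\<Sum>j\<le>n. \<bar>x (p j) - x (q j)\<bar>) = 1" if "x \<in> ?P" for x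
  proof -
    have "\<bar>x (p j) - x (q j)\<bar> = x (p j) + x (q j)" if "j \<le> n" for j
      using \<open>x \<in> ?P\<close> that by (force simp: P)
    then show ?thesis using that by (simp add: P)
  qed
  have r_pos: "r x > 0" if "x \<in> ?P" for x
  proof (rule ccontr)
    assume "\<not> r x > 0"
    moreover have "(\<Sum>j\<le>n. (x (p j) - x (q j))\<^sup>2) \<ge> 0"
      by (simp add: sum_nonneg)
    ultimately have "(\<Sum>j\<le>n. (x (p j) - x (q j))\<^sup>2) = 0"
      by (simp add: r_def)
    then have "\<forall>j\<in>{..n}. (x (p j) - x (q j))\<^sup>2 = 0"
      by (simp only: sum_nonneg_eq_0_iff finite_atMost zero_le_power2)
    with one[OF that] show False by simp
  qed
  have l_pos: "l y > 0" if "y \<in> ?Q" for y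
  proof (rule ccontr)
    assume "\<not> l y > 0"
    moreover have "l y \<ge> 0"
      by (simp add: l_def sum_nonneg)
    ultimately have "l y = 0" by simp
    then have "\<forall>j\<le>n. y j = 0"
      by (simp add: l_def sum_nonneg_eq_0_iff)
    with that show False by simp
  qed
  have G_p: "G y (p i) = max (y i) 0 / l y" and G_q: "G y (q i) = max (- y i) 0 / l y"
    if "i \<le> n" for y i
  proof -
    have "p i = p j \<longleftrightarrow> i = j" "q i = q j \<longleftrightarrow> i = j" "p i \<noteq> q j" "q i \<noteq> p j" for j
      using pq(1,2) pq(3)[of i j] pq(3)[of j i, symmetric] by (auto dest: injD)
    then show "G y (p i) = max (y i) 0 / l y" "G y (q i) = max (- y i) 0 / l y"
      using that by (simp_all add: G_def)
  qed
  have F_sphere: "F x \<in> ?Q" if "x \<in> ?P" for x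
  proof -
    have "(\<Sum>i\<le>n. (F x i)\<^sup>2) = (\<Sum>i\<le>n. (x (p i) - x (q i))\<^sup>2) / (r x)\<^sup>2"
      by (simp add: F_def power_divide sum_divide_distrib)
    also have "(r x)\<^sup>2 = (\<Sum>i\<le>n. (x (p i) - x (q i))\<^sup>2)"
      by (simp add: r_def sum_nonneg)
    finally show ?thesis
      using r_pos[OF that] by (simp add: F_def) (simp add: r_def)
  qed
  have G_realization: "G y \<in> ?P" if "y \<in> ?Q" for y
  proof -
    note lp = l_pos[OF that]
    have "0 \<le> G y v" for v
      unfolding G_def using lp by (intro divide_nonneg_pos sum_nonneg) auto
    moreover have "G y v = 0" if "v \<notin> p ` {..n} \<union> q ` {..n}" for v
      unfolding G_def using that by (auto intro!: sum.neutral)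
    moreover have "G y (p i) = 0 \<or> G y (q i) = 0" if "i \<le> n" for i
      using that by (auto simp: G_p G_q)
    moreover have "(\<Sum>i\<le>n. G y (p i) + G y (q i)) = 1"
    proof -
      have "(\<Sum>i\<le>n. G y (p i) + G y (q i)) = (\<Sum>i\<le>n. \<bar>y i\<bar> / l y)"
        by (rule sum.cong) (auto simp: G_p G_q max_def)
      also have "\<dots> = l y / l y" unfolding l_def by (rule sum_divide_distrib[symmetric])
      finally show ?thesis using lp by simp
    qed
    ultimately show ?thesis by (simp add: P)
  qed
  have GF: "G (F x) = x" if "x \<in> ?P" for x
  proof
    fix v
    note rp = r_pos[OF that]
    have "l (F x) = (\<Sum>j\<le>n. \<bar>x (p j) - x (q j)\<bar>) / r x"
      using rp by (simp add: l_def F_def sum_divide_distrib)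
    then have l: "l (F x) = 1 / r x" using one[OF that] by simp
    have pos: "max (F x i) 0 = x (p i) / r x" and neg: "max (- F x i) 0 = x (q i) / r x"
      if "i \<le> n" for i
    proof -
      have "0 \<le> x (p i)" "0 \<le> x (q i)" "x (p i) = 0 \<or> x (q i) = 0"
        using \<open>x \<in> ?P\<close> that by (auto simp: P)
      then show "max (F x i) 0 = x (p i) / r x" "max (- F x i) 0 = x (q i) / r x"
        using rp that by (auto simp: F_def max_def divide_le_0_iff zero_le_divide_iff)
    qed
    consider i where "i \<le> n" "v = p i" | i where "i \<le> n" "v = q i"
      | "v \<notin> p ` {..n} \<union> q ` {..n}" by auto
    then show "G (F x) v = x v"
    proof cases
      case 3
      then show ?thesis using that G_realization[OF F_sphere[OF that]] unfolding P by simp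
    qed (use rp in \<open>simp_all add: G_p G_q l pos neg\<close>)
  qed
  have FG: "F (G y) = y" if "y \<in> ?Q" for y
  proof
    fix i
    note lp = l_pos[OF that]
    have diff: "G y (p j) - G y (q j) = y j / l y" if "j \<le> n" for j
      using that by (simp add: G_p G_q max_def)
    have "(\<Sum>j\<le>n. (G y (p j) - G y (q j))\<^sup>2) = (\<Sum>j\<le>n. (y j)\<^sup>2) / (l y)\<^sup>2"
      by (simp add: diff power_divide sum_divide_distrib)
    also have "\<dots> = 1 / (l y)\<^sup>2" using that by simp
    finally have "r (G y) = 1 / l y"
      using lp by (simp add: r_def real_sqrt_divide)
    then show "F (G y) i = y i"
      using lp that by (simp add: F_def diff)
  qed
  have "continuous_on ?P F"
  proof (rule continuous_on_coordinatewise_then_product)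
    fix i
    have coord: "continuous_on ?P (\<lambda>x. x w)" for w
      by (rule continuous_on_product_then_coordinatewise) (rule continuous_on_id)
    have "continuous_on ?P r"
      unfolding r_def by (intro continuous_intros coord)
    moreover have "\<forall>x\<in>?P. r x \<noteq> 0"
    proof
      fix w assume "w \<in> ?P"
      from r_pos[OF this] show "r w \<noteq> 0" by simp
    qed
    ultimately have "continuous_on ?P (\<lambda>x. (x (p i) - x (q i)) / r x)"
      by (intro continuous_intros coord)
    then show "continuous_on ?P (\<lambda>x. F x i)"
      by (cases "i \<le> n") (simp_all add: F_def)
  qed
  moreover have "continuous_on ?Q G"
  proof (rule continuous_on_coordinatewise_then_product)
    fix v
    have part: "continuous_on ?Q (\<lambda>y. if b then f y else 0)" if "continuous_on ?Q f"
      for b and f :: "_ \<Rightarrow> real"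
      using that by (cases b) auto
    have coord: "continuous_on ?Q (\<lambda>y. y i)" for i
      by (rule continuous_on_product_then_coordinatewise) (rule continuous_on_id)
    have "continuous_on ?Q l"
      unfolding l_def by (intro continuous_intros coord)
    moreover have "\<forall>y\<in>?Q. l y \<noteq> 0"
    proof
      fix w assume "w \<in> ?Q"
      from l_pos[OF this] show "l w \<noteq> 0" by simp
    qed
    ultimately show "continuous_on ?Q (\<lambda>y. G y v)"
      unfolding G_def by (intro continuous_intros part coord)
  qed
  ultimately have "homeomorphic_maps (geom_realization (cross_polytope p q (Suc n))) (nsphere n) F G"
    unfolding homeomorphic_maps_def geom_realization_eq nsphere euclidean_product_topology
      continuous_map_subtopology_eu topspace_euclidean_subtopology
    using F_sphere G_realization GF FG by blast
  then show ?thesis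
    by (auto simp: homeomorphic_space_def)
qed

text \<open>
  A face of the larger complex is a face of the smaller one together with \<open>p c\<close>, with \<open>q c\<close> or with
  neither of them, whence the factor \<open>1 - 1 - 1\<close>.
\<close>

lemma alternating_sum_cross_polytope:
  assumes pq: "inj p" "inj q" "\<And>i j. p i \<noteq> q j"
  shows "(\<Sum>\<sigma>\<in>cross_polytope p q c. (-1) ^ card \<sigma> :: int) = (-1) ^ c"
proof (induction c)
  case 0
  have "cross_polytope p q 0 = {{}}" by (auto simp: cross_polytope_def)
  then show ?case by simp
next
  case (Suc c)
  let ?K = "cross_polytope p q c"
  have new: "p c \<notin> \<sigma>" "q c \<notin> \<sigma>" "finite \<sigma>" if "\<sigma> \<in> ?K" for \<sigma>
  proof -
    have "\<sigma> \<subseteq> p ` {..<c} \<union> q ` {..<c}" using that by (simp add: cross_polytope_def)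
    moreover have "p c \<notin> p ` {..<c} \<union> q ` {..<c}" "q c \<notin> p ` {..<c} \<union> q ` {..<c}"
      using pq(3) pq(3)[symmetric] by (auto simp: inj_eq[OF pq(1)] inj_eq[OF pq(2)])
    ultimately show "p c \<notin> \<sigma>" "q c \<notin> \<sigma>" "finite \<sigma>"
      by (auto intro: finite_subset)
  qed
  have "finite ?K"
    by (rule finite_subset[of _ "Pow (p ` {..<c} \<union> q ` {..<c})"]) (auto simp: cross_polytope_def)
  have cone: "(\<Sum>\<sigma>\<in>insert w ` ?K. (-1) ^ card \<sigma> :: int) = - (\<Sum>\<sigma>\<in>?K. (-1) ^ card \<sigma>)"
    if w: "\<And>\<sigma>. \<sigma> \<in> ?K \<Longrightarrow> w \<notin> \<sigma>" for w
  proof -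
    have "inj_on (insert w) ?K"
      using w by (intro inj_onI) (metis insert_ident)
    then have "(\<Sum>\<sigma>\<in>insert w ` ?K. (-1) ^ card \<sigma> :: int) = (\<Sum>\<sigma>\<in>?K. (-1) ^ card (insert w \<sigma>))"
      by (simp add: sum.reindex)
    also have "\<dots> = (\<Sum>\<sigma>\<in>?K. - ((-1) ^ card \<sigma>))"
      using w new(3) by (intro sum.cong) auto
    finally show ?thesis by (simp add: sum_negf)
  qed
  have decomp: "cross_polytope p q (Suc c) = ?K \<union> insert (p c) ` ?K \<union> insert (q c) ` ?K"
  proof (intro equalityI subsetI)
    fix \<sigma> assume \<sigma>: "\<sigma> \<in> cross_polytope p q (Suc c)"
    define \<tau> where "\<tau> = \<sigma> - {p c} - {q c}"
    have "\<tau> \<in> ?K"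
      using \<sigma> by (auto simp: \<tau>_def cross_polytope_def lessThan_Suc)
    moreover have "\<not> (p c \<in> \<sigma> \<and> q c \<in> \<sigma>)"
      using \<sigma> by (simp add: cross_polytope_def)
    then have "\<sigma> = \<tau> \<or> \<sigma> = insert (p c) \<tau> \<or> \<sigma> = insert (q c) \<tau>"
      by (auto simp: \<tau>_def)
    ultimately show "\<sigma> \<in> ?K \<union> insert (p c) ` ?K \<union> insert (q c) ` ?K"
      by auto
  next
    fix \<sigma> assume "\<sigma> \<in> ?K \<union> insert (p c) ` ?K \<union> insert (q c) ` ?K"
    then obtain \<tau> where \<tau>: "\<tau> \<in> ?K" "\<sigma> = \<tau> \<or> \<sigma> = insert (p c) \<tau> \<or> \<sigma> = insert (q c) \<tau>"
      by auto
    have ne: "p i \<noteq> q c" "q i \<noteq> p c" "p i = p c \<longleftrightarrow> i = c" "q i = q c \<longleftrightarrow> i = c" for i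
      using pq(1,2) pq(3)[of c i] pq(3)[of i c] by (auto dest: injD)
    show "\<sigma> \<in> cross_polytope p q (Suc c)"
      using \<tau> new(1,2)[OF \<tau>(1)] ne by (auto simp: cross_polytope_def less_Suc_eq lessThan_Suc)
  qed
  have "p c \<noteq> q c" by (rule pq(3))
  have "(\<Sum>\<sigma>\<in>cross_polytope p q (Suc c). (-1) ^ card \<sigma> :: int) =
      (\<Sum>\<sigma>\<in>?K. (-1) ^ card \<sigma>) + (\<Sum>\<sigma>\<in>insert (p c) ` ?K. (-1) ^ card \<sigma>)
      + (\<Sum>\<sigma>\<in>insert (q c) ` ?K. (-1) ^ card \<sigma>)"
    unfolding decomp
  proof (subst sum.union_disjoint)
    show "(?K \<union> insert (p c) ` ?K) \<inter> insert (q c) ` ?K = {}"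
    proof -
      have "q c \<notin> \<sigma>" if "\<sigma> \<in> ?K \<union> insert (p c) ` ?K" for \<sigma>
        using that new(2) \<open>p c \<noteq> q c\<close> by auto
      then show ?thesis by blast
    qed
    show "(\<Sum>\<sigma>\<in>?K \<union> insert (p c) ` ?K. (-1) ^ card \<sigma>) + (\<Sum>\<sigma>\<in>insert (q c) ` ?K. (-1) ^ card \<sigma>)
      = (\<Sum>\<sigma>\<in>?K. (-1) ^ card \<sigma>) + (\<Sum>\<sigma>\<in>insert (p c) ` ?K. (-1) ^ card \<sigma>)
      + (\<Sum>\<sigma>\<in>insert (q c) ` ?K. (-1) ^ card \<sigma> :: int)"
      using \<open>finite ?K\<close> new(1) by (subst sum.union_disjoint) auto
  qed (use \<open>finite ?K\<close> in auto)
  also have "\<dots> = - (\<Sum>\<sigma>\<in>?K. (-1) ^ card \<sigma>)"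
    using new(1,2) by (simp add: cone)
  finally show ?case using Suc by simp
qed

section \<open>Folding the even columns of the ladder\<close>

text \<open>The independence complex of the ladder without the columns \<open>2, 4, \<dots>, 2k\<close>.\<close>

definition ladder_complex :: "nat \<Rightarrow> nat \<Rightarrow> (int \<times> int) set set" where
  "ladder_complex m k =
     {\<sigma> \<in> indep_complex (cyl_graph m 2). \<forall>i j. (i, j) \<in> \<sigma> \<longrightarrow> even i \<longrightarrow> 2 * int k < i}"

lemma rows: "j \<in> {1..2} \<longleftrightarrow> j = 1 \<or> j = 2" for j :: int
  by auto

lemma ladder_adj:
  assumes "j \<in> {1..2}" "j' \<in> {1..2}"
  shows "cyl_adj 2 (i, j) (i', j') \<longleftrightarrow> i = i' \<and> j \<noteq> j' \<or> j = j' \<and> \<bar>i - i'\<bar> = 1"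
  using assms unfolding rows by (auto simp: cyl_adj_def cong_def)

lemma ladder_complex_iff:
  "\<sigma> \<in> ladder_complex m k \<longleftrightarrow>
     (\<forall>i j. (i, j) \<in> \<sigma> \<longrightarrow> i \<in> {1..int m} \<and> j \<in> {1..2} \<and> (even i \<longrightarrow> 2 * int k < i)) \<and>
     (\<forall>i j i' j'. (i, j) \<in> \<sigma> \<longrightarrow> (i', j') \<in> \<sigma> \<longrightarrow>
        \<not> (i = i' \<and> j \<noteq> j') \<and> \<not> (j = j' \<and> \<bar>i - i'\<bar> = 1))"
  (is "_ \<longleftrightarrow> ?vertices \<and> ?independent")
proof -
  let ?G = "cyl_graph m 2"
  have vertices: "?vertices \<longleftrightarrow> \<sigma> \<subseteq> pverts ?G \<and> (\<forall>i j. (i, j) \<in> \<sigma> \<longrightarrow> even i \<longrightarrow> 2 * int k < i)"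
    unfolding cyl_graph_def pair_pre_digraph.simps subset_iff split_paired_All mem_Times_iff
      fst_conv snd_conv of_nat_numeral by blast
  have arc: "((i, j), (i', j')) \<notin> parcs ?G \<longleftrightarrow>
      \<not> (i = i' \<and> j \<noteq> j') \<and> \<not> (j = j' \<and> \<bar>i - i'\<bar> = 1)"
    if ?vertices "(i, j) \<in> \<sigma>" "(i', j') \<in> \<sigma>" for i j i' j'
  proof -
    have "i \<in> {1..int m}" "i' \<in> {1..int m}" "j \<in> {1..2}" "j' \<in> {1..2}"
      using that by blast+
    then show ?thesis
      using ladder_adj[of j j' i i'] by (auto simp: cyl_graph_def)
  qed
  have "\<sigma> \<in> ladder_complex m k \<longleftrightarrow> ?vertices \<and>
     (\<forall>i j i' j'. (i, j) \<in> \<sigma> \<longrightarrow> (i', j') \<in> \<sigma> \<longrightarrow> ((i, j), (i', j')) \<notin> parcs ?G)"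
    unfolding vertices ladder_complex_def indep_complex_def mem_Collect_eq Ball_def
      split_paired_All by blast
  also have "\<dots> \<longleftrightarrow> ?vertices \<and> ?independent"
    by (intro conj_cong all_cong1 imp_cong refl arc)
  finally show ?thesis .
qed

lemma ladder_complex_subset:
  assumes "\<sigma> \<in> ladder_complex m k" "\<tau> \<subseteq> \<sigma>"
  shows "\<tau> \<in> ladder_complex m k"
  using assms unfolding ladder_complex_iff by blast

lemma ladder_complex_subset_Pow: "ladder_complex m k \<subseteq> Pow ({1..int m} \<times> {1..2})"
  by (auto simp: ladder_complex_iff)

lemma finite_ladder_complex: "finite (ladder_complex m k)"
  by (rule finite_subset[OF ladder_complex_subset_Pow]) simp

lemma finite_ladder_face: "\<sigma> \<in> ladder_complex m k \<Longrightarrow> finite \<sigma>"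
  using ladder_complex_subset_Pow[of m k]
  by (auto intro: finite_subset[of _ "{1..int m} \<times> {1..2}"])

text \<open>
  With column \<open>2k\<close> gone, the neighbours of \<open>(2k+1, 3-j)\<close> are \<open>(2k+1, j)\<close> and \<open>(2k+2, 3-j)\<close>, and
  both are neighbours of \<open>(2k+2, j)\<close>.
\<close>

lemma ladder_dominated:
  assumes \<sigma>: "\<sigma> \<in> ladder_complex m k" and v: "(2 * int k + 2, j) \<in> \<sigma>"
  shows "insert (2 * int k + 1, 3 - j) \<sigma> \<in> ladder_complex m k"
proof -
  let ?u = "(2 * int k + 1, 3 - j)"
  have V: "1 \<le> i" "i \<le> int m" "j' = 1 \<or> j' = 2" "even i \<longrightarrow> 2 * int k < i" if "(i, j') \<in> \<sigma>" for i j'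
    using \<sigma> that unfolding ladder_complex_iff rows atLeastAtMost_iff[of _ 1 "int m"] by blast+
  have ind: "\<not> (i = i' \<and> j \<noteq> j')" "\<not> (j = j' \<and> \<bar>i - i'\<bar> = 1)"
    if "(i, j) \<in> \<sigma>" "(i', j') \<in> \<sigma>" for i j i' j'
    using \<sigma> that unfolding ladder_complex_iff by blast+
  have u: "\<not> (2 * int k + 1 = i \<and> 3 - j \<noteq> j')" "\<not> (3 - j = j' \<and> \<bar>2 * int k + 1 - i\<bar> = 1)"
    if "(i, j') \<in> \<sigma>" for i j'
  proof -
    note facts = V[OF that] V[OF v] ind[OF v that]
    show "\<not> (2 * int k + 1 = i \<and> 3 - j \<noteq> j')"
      using facts by auto
    show "\<not> (3 - j = j' \<and> \<bar>2 * int k + 1 - i\<bar> = 1)"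
    proof
      assume a: "3 - j = j' \<and> \<bar>2 * int k + 1 - i\<bar> = 1"
      (* Column 2k carries no vertex of the face, and (2k+2, 3-j) is adjacent to (2k+2, j). *)
      then have "i = 2 * int k \<or> i = 2 * int k + 2" by arith
      with a facts show False by auto
    qed
  qed
  show ?thesis
    unfolding ladder_complex_iff
  proof (rule conjI; intro allI impI)
    fix i j' assume "(i, j') \<in> insert ?u \<sigma>"
    then show "i \<in> {1..int m} \<and> j' \<in> {1..2} \<and> (even i \<longrightarrow> 2 * int k < i)"
      using V[of i j'] V[OF v] by auto
  next
    fix i j1 i' j2 assume "(i, j1) \<in> insert ?u \<sigma>" "(i', j2) \<in> insert ?u \<sigma>"
    then show "\<not> (i = i' \<and> j1 \<noteq> j2) \<and> \<not> (j1 = j2 \<and> \<bar>i - i'\<bar> = 1)"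
      using ind[of i j1 i' j2] u[of i j1] u[of i' j2] by (auto simp: abs_minus_commute)
  qed
qed

text \<open>
  Both vertices of column \<open>2k+2\<close> are removed in turn; the second removal is legitimate in the
  complex left by the first, as the vertex that dominates lies in column \<open>2k+1\<close>.
\<close>

lemma ladder_remove_column:
  "geom_realization (ladder_complex m k)
     homotopy_equivalent_space geom_realization (ladder_complex m (Suc k))"
  "(\<Sum>\<sigma>\<in>ladder_complex m k. (-1) ^ card \<sigma> :: int) = (\<Sum>\<sigma>\<in>ladder_complex m (Suc k). (-1) ^ card \<sigma>)"
proof -
  let ?v = "\<lambda>j. (2 * int k + 2, j :: int)"
  let ?u = "\<lambda>j. (2 * int k + 1, 3 - j :: int)"
  let ?K = "ladder_complex m k"
  define K1 where "K1 = {\<sigma>\<in>?K. ?v 1 \<notin> \<sigma>}"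
  have K2: "ladder_complex m (Suc k) = {\<sigma>\<in>K1. ?v 2 \<notin> \<sigma>}"
  proof (intro set_eqI iffI)
    fix \<sigma> assume \<sigma>: "\<sigma> \<in> {\<sigma>\<in>K1. ?v 2 \<notin> \<sigma>}"
    have "2 * int (Suc k) < i" if "(i, j) \<in> \<sigma>" "even i" for i j
    proof -
      have "2 * int k < i" "j = 1 \<or> j = 2"
        using \<sigma> that unfolding K1_def ladder_complex_iff rows by blast+
      moreover from this(2) have "i \<noteq> 2 * int k + 2"
        using \<sigma> that(1) by (auto simp: K1_def)
      ultimately show ?thesis using \<open>even i\<close> by presburger
    qed
    with \<sigma> show "\<sigma> \<in> ladder_complex m (Suc k)"
      unfolding K1_def ladder_complex_def by blast
  qed (fastforce simp: K1_def ladder_complex_def)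
  have down1: "\<sigma> \<in> K1 \<Longrightarrow> \<tau> \<subseteq> \<sigma> \<Longrightarrow> \<tau> \<in> K1" for \<sigma> \<tau>
    using ladder_complex_subset by (auto simp: K1_def)
  have dom1: "\<sigma> \<in> K1 \<Longrightarrow> ?v 2 \<in> \<sigma> \<Longrightarrow> insert (?u 2) \<sigma> \<in> K1" for \<sigma>
    using ladder_dominated[of \<sigma> m k 2] by (auto simp: K1_def)
  have fin1: "finite K1" "\<And>\<sigma>. \<sigma> \<in> K1 \<Longrightarrow> finite \<sigma>"
    using finite_ladder_complex finite_ladder_face by (auto simp: K1_def)
  have "geom_realization ?K homotopy_equivalent_space geom_realization K1"
    unfolding K1_def
    by (rule realization_remove_dominated[of _ "?v 1" "?u 1"])
      (fact finite_ladder_face, fact ladder_complex_subset, fact ladder_dominated, simp)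
  moreover have "geom_realization K1 homotopy_equivalent_space geom_realization {\<sigma>\<in>K1. ?v 2 \<notin> \<sigma>}"
    by (rule realization_remove_dominated[of _ "?v 2" "?u 2"])
      (fact fin1, fact down1, fact dom1, simp)
  ultimately show "geom_realization ?K
      homotopy_equivalent_space geom_realization (ladder_complex m (Suc k))"
    unfolding K2 by (rule homotopy_eqv_trans)
  have "(\<Sum>\<sigma>\<in>?K. (-1) ^ card \<sigma> :: int) = (\<Sum>\<sigma>\<in>K1. (-1) ^ card \<sigma>)"
    unfolding K1_def
    by (rule alternating_sum_remove_dominated[of _ "?v 1" "?u 1"])
      (fact finite_ladder_complex, fact finite_ladder_face, fact ladder_complex_subset,
        fact ladder_dominated, simp)
  also have "\<dots> = (\<Sum>\<sigma> | \<sigma> \<in> K1 \<and> ?v 2 \<notin> \<sigma>. (-1) ^ card \<sigma>)"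
    by (rule alternating_sum_remove_dominated[of _ "?v 2" "?u 2"])
      (fact fin1(1), fact fin1(2), fact down1, fact dom1, simp)
  finally show "(\<Sum>\<sigma>\<in>?K. (-1) ^ card \<sigma> :: int) =
      (\<Sum>\<sigma>\<in>ladder_complex m (Suc k). (-1) ^ card \<sigma>)"
    unfolding K2 .
qed

lemma ladder_remove_columns:
  "geom_realization (ladder_complex m 0) homotopy_equivalent_space geom_realization (ladder_complex m k)
   \<and> (\<Sum>\<sigma>\<in>ladder_complex m 0. (-1) ^ card \<sigma> :: int) = (\<Sum>\<sigma>\<in>ladder_complex m k. (-1) ^ card \<sigma>)"
proof (induction k)
  case (Suc k)
  then show ?case
    using ladder_remove_column[of m k] homotopy_eqv_trans by metis
qed (simp add: homotopy_equivalent_space_refl)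

lemma ladder_complex_0: "ladder_complex m 0 = indep_complex (cyl_graph m 2)"
  by (auto simp: ladder_complex_def indep_complex_def cyl_graph_def)

text \<open>
  Removing the even columns up to \<open>2m\<close> certainly removes all of them.  The odd columns are pairwise
  non-adjacent, so the only condition left on a face is that it does not contain both vertices of
  a column.
\<close>

lemma ladder_complex_odd_columns:
  "ladder_complex m m =
     cross_polytope (\<lambda>i. (2 * int i + 1, 1)) (\<lambda>i. (2 * int i + 1, 2)) ((m + 1) div 2)"
  (is "_ = cross_polytope ?p ?q ?c")
proof (intro set_eqI iffI)
  fix \<sigma> assume \<sigma>: "\<sigma> \<in> ladder_complex m m"
  have "w \<in> ?p ` {..<?c} \<union> ?q ` {..<?c}" if "w \<in> \<sigma>" for w
  proof -
    obtain i j where w: "w = (i, j)" by force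
    have "i \<in> {1..int m}" and j: "j = 1 \<or> j = 2" and "even i \<longrightarrow> 2 * int m < i"
      using \<sigma> that unfolding ladder_complex_iff rows w by blast+
    then have i: "1 \<le> i" "i \<le> int m" "odd i" by auto
    from \<open>odd i\<close> obtain a where "i = 2 * a + 1" by (rule oddE)
    with i have "i = 2 * int (nat a) + 1" and "nat a \<in> {..<?c}" by auto
    with j w have "w = ?p (nat a) \<or> w = ?q (nat a)" by simp
    with \<open>nat a \<in> {..<?c}\<close> show ?thesis by blast
  qed
  moreover have "\<not> (?p i \<in> \<sigma> \<and> ?q i \<in> \<sigma>)" for i
  proof -
    have "(1 :: int) \<noteq> 2" by simp
    with \<sigma> show ?thesis unfolding ladder_complex_iff by blast
  qed
  ultimately show "\<sigma> \<in> cross_polytope ?p ?q ?c"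
    unfolding cross_polytope_def by blast
next
  fix \<sigma> assume \<sigma>: "\<sigma> \<in> cross_polytope ?p ?q ?c"
  have V: "\<exists>a. i = 2 * int a + 1 \<and> a < ?c \<and> (j = 1 \<or> j = 2)" if "(i, j) \<in> \<sigma>" for i j
    using \<sigma> that unfolding cross_polytope_def by auto
  have one: "\<not> (?p a \<in> \<sigma> \<and> ?q a \<in> \<sigma>)" if "a < ?c" for a
    using \<sigma> that unfolding cross_polytope_def by auto
  show "\<sigma> \<in> ladder_complex m m"
    unfolding ladder_complex_iff
  proof (rule conjI; intro allI impI)
    fix i j assume "(i, j) \<in> \<sigma>"
    from V[OF this] show "i \<in> {1..int m} \<and> j \<in> {1..2} \<and> (even i \<longrightarrow> 2 * int m < i)"
      by auto
  next
    fix i j i' j' assume *: "(i, j) \<in> \<sigma>" "(i', j') \<in> \<sigma>"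
    obtain a b where ab: "i = 2 * int a + 1" "a < ?c" "j = 1 \<or> j = 2"
      "i' = 2 * int b + 1" "b < ?c" "j' = 1 \<or> j' = 2"
      using V[OF *(1)] V[OF *(2)] by blast
    have "\<bar>i - i'\<bar> \<noteq> 1" unfolding ab by presburger
    moreover have "\<not> (i = i' \<and> j \<noteq> j')"
      using one[of a] * ab by auto
    ultimately show "\<not> (i = i' \<and> j \<noteq> j') \<and> \<not> (j = j' \<and> \<bar>i - i'\<bar> = 1)" by blast
  qed
qed

theorem proposition3p1:
  fixes m :: nat
  assumes "m \<ge> 1"
  shows "geom_realization (indep_complex (cyl_graph m 2))
           homotopy_equivalent_space nsphere (nat (\<lceil>real m / 2\<rceil> - 1))
       \<and> indep_Z (cyl_graph m 2) = (-1) ^ nat \<lceil>real m / 2\<rceil>"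
proof -
  let ?p = "\<lambda>i. (2 * int i + 1, 1 :: int)" and ?q = "\<lambda>i. (2 * int i + 1, 2 :: int)"
  have pq: "inj ?p" "inj ?q" "\<And>i j. ?p i \<noteq> ?q j" by (auto intro: injI)
  (* There is at least one odd column, so the number of odd columns is a successor and the
     dimension of the sphere is not truncated. *)
  define n where "n = (m + 1) div 2 - 1"
  have n: "(m + 1) div 2 = Suc n" using assms by (simp add: n_def)
  then have "2 * Suc n = m \<or> 2 * Suc n = m + 1" by presburger
  then have ceil: "\<lceil>real m / 2\<rceil> = int (Suc n)"
    by (intro ceiling_unique) (auto simp: field_simps)
  have K: "ladder_complex m m = cross_polytope ?p ?q (Suc n)"
    unfolding ladder_complex_odd_columns n ..
  have "geom_realization (indep_complex (cyl_graph m 2)) homotopy_equivalent_space nsphere n"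
    using ladder_remove_columns[of m m] cross_polytope_homeomorphic_nsphere[OF pq, of n]
      homotopy_eqv_trans homeomorphic_imp_homotopy_equivalent_space
    unfolding ladder_complex_0 K by blast
  moreover have "indep_Z (cyl_graph m 2) = (-1) ^ Suc n"
    using ladder_remove_columns[of m m] alternating_sum_cross_polytope[OF pq, of "Suc n"]
    unfolding ladder_complex_0 K indep_Z_def by simp
  moreover have "nat \<lceil>real m / 2\<rceil> = Suc n" "nat (\<lceil>real m / 2\<rceil> - 1) = n"
    by (simp_all add: ceil nat_add_distrib)
  ultimately show ?thesis by simp
qed

end
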